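(* Let $F=P/Q$ be a rational function ($P,Q$ complex polynomials) with no principal part, i.e. $\deg P<\deg Q$, which is positive on the unit circle $\mathbb{T}$, i.e. $F$ has no poles on $\mathbb{T}$ and $F(\zeta)\ge 0$ for all $\zeta\in\mathbb{T}$. For an integer $k\ge 0$ let $c_k=\frac1{2\pi}\int_0^{2\pi}F(e^{it})e^{-ikt}\,dt$ be the coefficient of order $k$ of $F$ on $\mathbb{T}$. Then $$|c_k|\le c_0\,\omega_2(R^k),$$ where $R=S^*|\operatorname{Ker}(Q(S^* ))$.
   Context: $S^*$ is the backward shift on $\ell^2$: $S^*(x_0,x_1,\dots)=(x_1,x_2,\dots)$. $R$ is its restriction to the invariant subspace $\operatorname{Ker}(Q(S^* ))$. For an operator $A$ on a Hilbert space $H$, $\omega_2(A)=\sup\{|\langle Ax\mid x\rangle|:x\in H,\|x\|=1\}$ is the numerical radius. *)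

theory Defs
  imports "HOL-Complex_Analysis.Complex_Analysis"
begin

text \<open>The complex Hilbert space of square-summable sequences is represented as a set of
  functions. The inner product is linear in its first argument.\<close>

definition ell2 :: "(nat \<Rightarrow> complex) set" where
  "ell2 = {x. summable (\<lambda>n. (cmod (x n))\<^sup>2)}"

definition ell2_inner :: "(nat \<Rightarrow> complex) \<Rightarrow> (nat \<Rightarrow> complex) \<Rightarrow> complex" where
  "ell2_inner x y = (\<Sum>n. x n * cnj (y n))"

definition ell2_norm :: "(nat \<Rightarrow> complex) \<Rightarrow> real" where
  "ell2_norm x = sqrt (\<Sum>n. (cmod (x n))\<^sup>2)"

definition backward_shift :: "(nat \<Rightarrow> complex) \<Rightarrow> (nat \<Rightarrow> complex)" where
  "backward_shift x = (\<lambda>n. x (Suc n))"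

definition poly_op ::
  "complex poly \<Rightarrow> ((nat \<Rightarrow> complex) \<Rightarrow> (nat \<Rightarrow> complex)) \<Rightarrow> (nat \<Rightarrow> complex) \<Rightarrow> (nat \<Rightarrow> complex)" where
  "poly_op Q A x = (\<lambda>n. \<Sum>i\<le>degree Q. coeff Q i * (A ^^ i) x n)"

definition ker_shift :: "complex poly \<Rightarrow> (nat \<Rightarrow> complex) set" where
  "ker_shift Q = {x \<in> ell2. poly_op Q backward_shift x = (\<lambda>n. 0)}"

definition restricted_shift :: "complex poly \<Rightarrow> (nat \<Rightarrow> complex) \<Rightarrow> (nat \<Rightarrow> complex)" where
  "restricted_shift Q = restrict backward_shift (ker_shift Q)"

text \<open>Numerical radius of a bounded operator \<open>A\<close> on a closed subspace \<open>H\<close> of \<open>ell2\<close>.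
  For \<open>H = {0}\<close> there are no unit vectors, and the value is the unspecified real
  \<open>Sup {}\<close>.\<close>

definition numerical_radius ::
  "(nat \<Rightarrow> complex) set \<Rightarrow> ((nat \<Rightarrow> complex) \<Rightarrow> (nat \<Rightarrow> complex)) \<Rightarrow> real" where
  "numerical_radius H A = Sup {cmod (ell2_inner (A x) x) | x. x \<in> H \<and> ell2_norm x = 1}"

definition circle_coeff :: "(complex \<Rightarrow> complex) \<Rightarrow> nat \<Rightarrow> complex" where
  "circle_coeff F k = 1 / (2 * of_real pi) *
     integral {0..2 * pi} (\<lambda>t. F (exp (\<i> * of_real t)) * exp (- \<i> * of_nat k * of_real t))"

text \<open>Invariance of the kernel, so that iterating the restriction never leaves the domain on
  which \<^const>\<open>restrict\<close> is specified.\<close>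

lemma backward_shift_ker_shift:
  assumes "x \<in> ker_shift Q"
  shows "backward_shift x \<in> ker_shift Q"
proof -
  have pow: "(backward_shift ^^ i) y n = y (n + i)" for i y n
    by (induction i arbitrary: n) (auto simp: backward_shift_def)
  have "summable (\<lambda>n. (cmod (x n))\<^sup>2)" and
    z: "\<And>n. (\<Sum>i\<le>degree Q. coeff Q i * x (n + i)) = 0"
    using assms by (auto simp: ker_shift_def ell2_def poly_op_def pow fun_eq_iff)
  then have "summable (\<lambda>n. (cmod (x (Suc n)))\<^sup>2)"
    by (subst summable_Suc_iff)
  then show ?thesis
    using z[of "Suc _"]
    by (auto simp: ker_shift_def ell2_def poly_op_def pow fun_eq_iff)
       (auto simp: backward_shift_def)
qed

lemma restricted_shift_power:
  assumes "x \<in> ker_shift Q"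
  shows "(restricted_shift Q ^^ k) x = (backward_shift ^^ k) x"
    and "(restricted_shift Q ^^ k) x \<in> ker_shift Q"
  using assms
  by (induction k) (auto simp: restricted_shift_def backward_shift_ker_shift)

end

theory Submission
  imports
    Defs
    "HOL-Computational_Algebra.Fundamental_Theorem_Algebra"
    "HOL-Computational_Algebra.Polynomial_Factorial"
    "HOL-Computational_Algebra.Field_as_Ring"
begin

text \<open>
  Cancel common factors of \<open>P\<close> and \<open>Q\<close>, and let \<open>Q0\<close> collect the zeros of the denominator inside
  the unit disc. Since \<open>F\<close> is real on the circle, its poles are symmetric under inversion, so
  \<open>F * |Q0|^2\<close> is there a nonnegative trigonometric polynomial of degree less than \<open>degree Q0\<close>.
  By the Fejer-Riesz theorem it equals \<open>|A|^2\<close> with \<open>degree A < degree Q0\<close>, hence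
  \<open>F = |A / Q0|^2\<close>. The coefficients \<open>a\<close> of the expansion of \<open>A / Q0\<close> at infinity satisfy the linear
  recurrence with characteristic polynomial \<open>Q0\<close>, so \<open>a\<close> lies in the kernel of \<open>Q(S*)\<close>, and
  multiplying out gives \<open>c_k = cnj <R^k a, a>\<close> and \<open>c_0 = ||a||^2\<close>.
\<close>

subsection \<open>The Fejer-Riesz theorem\<close>

lemma infinite_unit_circle: "infinite {z :: complex. cmod z = 1}"
proof -
  have "infinite (sphere 0 1 :: complex set)"
  proof
    assume "finite (sphere 0 1 :: complex set)"
    then obtain a where "sphere 0 1 = {a :: complex}"
      using connected_finite_iff_sing[of "sphere 0 1 :: complex set"] by (auto simp: connected_sphere_eq)
    moreover have "(- 1 :: complex) \<in> sphere 0 1" "(1 :: complex) \<in> sphere 0 1"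
      by auto
    ultimately show False
      by (metis one_neq_neg_one singletonD)
  qed
  then show ?thesis by (simp add: sphere_def)
qed

text \<open>A nonzero difference has finitely many zeros, while the circle without \<open>S\<close>
  is infinite. This turns identities that rely on \<open>cnj z = inverse z\<close> into polynomial
  identities.\<close>

lemma poly_eq_if_eq_on_circle:
  fixes p q :: "complex poly"
  assumes "finite S" and eq: "\<And>z. cmod z = 1 \<Longrightarrow> z \<notin> S \<Longrightarrow> poly p z = poly q z"
  shows "p = q"
proof (rule ccontr)
  assume "p \<noteq> q"
  then have "finite {z. poly (p - q) z = 0}"
    by (intro poly_roots_finite) auto
  moreover have "{z. cmod z = 1} \<subseteq> S \<union> {z. poly (p - q) z = 0}"
    using eq by auto
  ultimately show False
    using infinite_unit_circle \<open>finite S\<close> by (meson finite_UnI finite_subset)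
qed

text \<open>Each point of the circle is a limit of points of the circle outside \<open>S\<close>.
  This carries nonnegativity over to points where a vanishing factor cannot be divided out.\<close>

lemma closed_property_on_circle:
  fixes f :: "complex \<Rightarrow> 'a::t1_space"
  assumes "finite S" "continuous_on UNIV f" "closed T"
    and T: "\<And>z. cmod z = 1 \<Longrightarrow> z \<notin> S \<Longrightarrow> f z \<in> T"
    and a: "cmod a = 1"
  shows "f a \<in> T"
proof -
  have "closed (f -` T)"
    using assms(2,3) by (auto simp: continuous_on_closed_vimage)
  moreover have "a islimpt (sphere 0 1)"
    using a infinite_unit_circle
    by (intro connected_imp_perfect connected_sphere) (auto simp: sphere_def)
  then have "a islimpt (S \<union> (sphere 0 1 - S))"
    by (rule islimpt_subset) auto
  then have "a islimpt (sphere 0 1 - S)"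
    using islimpt_Un_finite \<open>finite S\<close> by blast
  then have "a islimpt (f -` T)"
    by (rule islimpt_subset) (use T in auto)
  ultimately show ?thesis
    by (auto simp: closed_limpt)
qed

section \<open>Conjugate reversal of polynomials\<close>

lemma cnj_eq_inverse_on_circle: "cmod z = 1 \<Longrightarrow> cnj z = inverse z"
  by (simp add: inverse_complex_def complex_eq_iff norm_complex_def)

text \<open>For \<open>degree p \<le> n\<close> this is the reciprocal polynomial
  \<open>z ^ n * cnj (p (1 / cnj z))\<close>; its nonzero zeros are the mirror images in the circle
  of those of \<open>p\<close>. The length \<open>n\<close> may be any degree bound.\<close>

definition conj_reflect :: "nat \<Rightarrow> complex poly \<Rightarrow> complex poly" where
  "conj_reflect n p = (\<Sum>i\<le>n. monom (cnj (coeff p (n - i))) i)"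

lemma coeff_conj_reflect: "coeff (conj_reflect n p) i = (if i \<le> n then cnj (coeff p (n - i)) else 0)"
  by (auto simp: conj_reflect_def coeff_sum)

lemma degree_conj_reflect_le: "degree (conj_reflect n p) \<le> n"
  by (rule degree_le) (auto simp: coeff_conj_reflect)

lemma poly_conj_reflect:
  assumes "degree p \<le> n" "z \<noteq> 0"
  shows "poly (conj_reflect n p) z = z ^ n * cnj (poly p (inverse (cnj z)))"
proof -
  have "poly p w = (\<Sum>i\<le>n. coeff p i * w ^ i)" for w
    unfolding poly_altdef by (rule sum.mono_neutral_left) (use assms(1) in \<open>auto simp: coeff_eq_0\<close>)
  then have "z ^ n * cnj (poly p (inverse (cnj z))) = (\<Sum>i\<le>n. cnj (coeff p i) * (z ^ n * inverse z ^ i))"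
    by (simp add: sum_distrib_left mult_ac)
  also have "\<dots> = (\<Sum>i\<le>n. cnj (coeff p i) * z ^ (n - i))"
    using assms(2) by (intro sum.cong) (auto simp: power_diff power_inverse divide_inverse)
  also have "\<dots> = (\<Sum>i\<le>n. cnj (coeff p (n - i)) * z ^ i)"
    by (rule sum.reindex_bij_witness[of _ "\<lambda>i. n - i" "\<lambda>i. n - i"]) auto
  also have "\<dots> = poly (conj_reflect n p) z"
    by (simp add: conj_reflect_def poly_sum poly_monom)
  finally show ?thesis ..
qed

lemma poly_conj_reflect_circle:
  assumes "degree p \<le> n" "cmod z = 1"
  shows "poly (conj_reflect n p) z = z ^ n * cnj (poly p z)"
proof -
  have "inverse (cnj z) = z" "z \<noteq> 0" using assms(2) by (auto simp: cnj_eq_inverse_on_circle)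
  then show ?thesis using poly_conj_reflect[OF assms(1)] by simp
qed

lemma nonneg_on_circle_double_root:
  assumes nonneg: "\<And>z. cmod z = 1 \<Longrightarrow> cnj z ^ n * poly p z \<in> \<real>\<^sub>\<ge>\<^sub>0"
    and \<alpha>: "cmod \<alpha> = 1" and "poly p \<alpha> = 0"
  shows "[:-\<alpha>, 1:] * [:-\<alpha>, 1:] dvd p"
proof -
  \<comment> \<open>The nonnegative function \<open>t \<mapsto> z^-n p(z)\<close> with \<open>z = cis t\<close> has a minimum at the zero,
    so its derivative vanishes there.\<close>
  obtain p1 where p1: "p = [:-\<alpha>, 1:] * p1"
    using \<open>poly p \<alpha> = 0\<close> by (auto simp: poly_eq_0_iff_dvd)
  obtain t0 where t0: "\<alpha> = cis t0"
    using \<alpha> by (metis cis_Arg norm_eq_zero zero_neq_one sgn_eq div_by_1 of_real_1)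
  \<comment> \<open>\<open>G\<close> is an entire function with \<open>G (of_real t) = g t\<close>.
    The factor vanishing at \<open>t0\<close> leaves one term of the product rule, so
    \<open>D\<close> is a nonzero multiple of \<open>poly p1 \<alpha>\<close>.\<close>
  define G where "G w = exp (- \<i> * of_nat n * w) * (exp (\<i> * w) - \<alpha>) * poly p1 (exp (\<i> * w))" for w
  define g where "g t = cnj (cis t) ^ n * poly p (cis t)" for t
  define D where "D = exp (- \<i> * of_nat n * of_real t0) * (\<i> * \<alpha>) * poly p1 \<alpha>"
  have "(G has_field_derivative D) (at (of_real t0))"
    unfolding G_def by (auto intro!: derivative_eq_intros simp: D_def t0 cis_conv_exp)
  then have "((\<lambda>t. G (of_real t)) has_vector_derivative D) (at t0)"
    by (rule has_vector_derivative_real_field)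
  moreover have "G (of_real t) = g t" for t
    by (simp add: G_def g_def p1 cis_conv_exp exp_cnj algebra_simps flip: exp_of_nat_mult)
  ultimately have g: "(g has_vector_derivative D) (at t0)"
    by simp
  have g_nn: "g t \<in> \<real>\<^sub>\<ge>\<^sub>0" for t
    unfolding g_def by (rule nonneg) auto
  have "g t0 = 0" by (simp add: g_def t0[symmetric] \<open>poly p \<alpha> = 0\<close>)
  have "((\<lambda>t. Re (g t)) has_real_derivative Re D) (at t0)"
    using g by (simp add: has_vector_derivative_complex_iff)
  then have "Re D = 0"
    by (rule DERIV_local_min[where d = 1])
       (use g_nn in \<open>auto simp: \<open>g t0 = 0\<close> complex_nonneg_Reals_iff\<close>)
  have "((\<lambda>t. Im (g t)) has_real_derivative Im D) (at t0)"
    using g by (simp add: has_vector_derivative_complex_iff)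
  moreover have "Im (g t) = 0" for t using g_nn[of t] by (simp add: complex_nonneg_Reals_iff)
  ultimately have "Im D = 0"
    using DERIV_unique[OF _ DERIV_const] by simp
  with \<open>Re D = 0\<close> have "D = 0" by (simp add: complex_eq_iff)
  then have "poly p1 \<alpha> = 0" using \<alpha> by (auto simp: D_def)
  then show ?thesis by (simp only: p1 poly_eq_0_iff_dvd mult_dvd_mono dvd_refl)
qed

text \<open>By induction on \<open>n\<close>: split off either a zero at the origin, whose
  counterpart is a missing top coefficient, or a pair of mirror zeros, which contributes
  \<open>|z - \<alpha>|^2\<close> up to a constant.\<close>

lemma Fejer_Riesz:
  assumes "degree p \<le> 2 * n" and "\<And>z. cmod z = 1 \<Longrightarrow> cnj z ^ n * poly p z \<in> \<real>\<^sub>\<ge>\<^sub>0"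
  shows "\<exists>A. degree A \<le> n \<and> (\<forall>z. cmod z = 1 \<longrightarrow> cnj z ^ n * poly p z = of_real ((cmod (poly A z))\<^sup>2))"
  using assms
proof (induction n arbitrary: p)
  case 0
  then obtain c where c: "p = [:c:]" by (auto elim: degree_eq_zeroE)
  with 0(2)[of 1] have "c \<in> \<real>\<^sub>\<ge>\<^sub>0" by simp
  then obtain r where "c = of_real r" "r \<ge> 0" by (auto elim: nonneg_Reals_cases)
  then show ?case by (intro exI[of _ "[:of_real (sqrt r):]"]) (simp add: c)
next
  case (Suc n)
  \<comment> \<open>Real values on the circle make \<open>p\<close> its own reversal: coefficients
    are symmetric up to conjugation, and nonzero zeros pair up as \<open>\<alpha>\<close> and
    \<open>1 / cnj \<alpha>\<close>.\<close>
  have self: "p = conj_reflect (2 * Suc n) p"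
  proof (rule poly_eq_if_eq_on_circle[of "{}"])
    fix z :: complex assume z: "cmod z = 1"
    have "cnj z ^ Suc n * poly p z \<in> \<real>" by (rule subsetD[OF nonneg_Reals_subset_Reals Suc.prems(2)[OF z]])
    then have "cnj z ^ Suc n * poly p z = z ^ Suc n * cnj (poly p z)"
      using Reals_cnj_iff by fastforce
    then have "z ^ Suc n * (cnj z ^ Suc n * poly p z) = z ^ Suc n * (z ^ Suc n * cnj (poly p z))"
      by simp
    moreover have "z ^ Suc n * cnj z ^ Suc n = 1"
      using z by (simp only: power_mult_distrib[symmetric]) (simp add: complex_norm_square[symmetric])
    ultimately show "poly p z = poly (conj_reflect (2 * Suc n) p) z"
      using z Suc.prems(1)
      by (simp only: poly_conj_reflect_circle mult.assoc[symmetric] mult_2 power_add mult_1_left)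
  qed simp
  show ?case
  proof (cases "poly p 0 = 0")
    case True
    then obtain p1 where p1: "p = pCons 0 p1"
      by (metis pCons_cases poly_pCons mult_zero_left add_0_right)
    \<comment> \<open>By symmetry the top coefficient vanishes with the constant one, so splitting
      off \<open>z\<close> leaves degree at most \<open>2 * n\<close>; the removed \<open>z\<close>
      cancels one factor \<open>cnj z\<close>.\<close>
    have "coeff p (2 * Suc n) = 0"
      using True by (subst self) (simp add: coeff_conj_reflect poly_0_coeff_0)
    then have d: "degree p1 \<le> 2 * n"
    proof (cases "p1 = 0")
      case False
      then have "coeff p (degree p) \<noteq> 0" "degree p = Suc (degree p1)" by (auto simp: p1)
      then show ?thesis
        using Suc.prems(1) \<open>coeff p (2 * Suc n) = 0\<close> by (cases "degree p = 2 * Suc n") auto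
    qed simp
    have eq: "cnj z ^ Suc n * poly p z = cnj z ^ n * poly p1 z" if "cmod z = 1" for z
      using that by (cases "z = 0") (auto simp: p1 cnj_eq_inverse_on_circle)
    obtain A where "degree A \<le> n" "\<forall>z. cmod z = 1 \<longrightarrow> cnj z ^ n * poly p1 z = of_real ((cmod (poly A z))\<^sup>2)"
      using Suc.IH[OF d] Suc.prems(2) eq by metis
    then show ?thesis using eq by (intro exI[of _ A]) auto
  next
    case False
    then have "coeff p (2 * Suc n) \<noteq> 0"
      by (subst self) (simp add: coeff_conj_reflect poly_0_coeff_0)
    then have deg: "degree p = 2 * Suc n" using Suc.prems(1) by (meson le_antisym le_degree)
    then obtain \<alpha> where \<alpha>: "poly p \<alpha> = 0"
      using alg_closed_imp_poly_has_root[of p] by auto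
    then have "\<alpha> \<noteq> 0" using False by auto
    define \<beta> where "\<beta> = inverse (cnj \<alpha>)"
    have "\<beta> \<noteq> 0" using \<open>\<alpha> \<noteq> 0\<close> by (simp add: \<beta>_def)
    have \<beta>: "poly p \<beta> = 0"
      using \<open>\<alpha> \<noteq> 0\<close> \<alpha> Suc.prems(1) by (subst self) (simp add: \<beta>_def poly_conj_reflect)
    \<comment> \<open>Distinct mirror zeros split off separately. If they coincide,
      \<open>\<alpha>\<close> lies on the circle and nonnegativity makes it a double zero.\<close>
    have "[:-\<alpha>, 1:] * [:-\<beta>, 1:] dvd p"
    proof (cases "\<alpha> = \<beta>")
      case True
      then have "cmod \<alpha> = inverse (cmod \<alpha>)" unfolding \<beta>_def by (metis norm_inverse complex_mod_cnj)
      then have "cmod \<alpha> = 1"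
        using \<open>\<alpha> \<noteq> 0\<close> by (simp add: field_simps power2_eq_square[symmetric] power2_eq_1_iff)
          (smt (verit) norm_ge_zero power2_eq_1_iff power2_eq_square)
      then show ?thesis
        using nonneg_on_circle_double_root[of "Suc n" p \<alpha>] Suc.prems(2) \<alpha> True by metis
    next
      case False
      obtain p1 where p1: "p = [:-\<alpha>, 1:] * p1" using \<alpha> by (auto simp: poly_eq_0_iff_dvd)
      then have "poly p1 \<beta> = 0" using \<beta> False by auto
      then show ?thesis by (simp only: p1 poly_eq_0_iff_dvd mult_dvd_mono dvd_refl)
    qed
    then obtain p2 where p2: "p = [:-\<alpha>, 1:] * [:-\<beta>, 1:] * p2" by (elim dvdE)
    \<comment> \<open>The constant comes from
      \<open>cnj z * (z - \<beta>) = - \<beta> * cnj (z - \<alpha>)\<close> on the circle, which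
      turns the two linear factors into \<open>|z - \<alpha>|^2\<close>.\<close>
    define p1 where "p1 = smult (-\<beta>) p2"
    have "p2 \<noteq> 0" using deg p2 by auto
    then have "degree p = 2 + degree p2"
      unfolding p2 by (subst degree_mult_eq) (auto simp: degree_mult_eq)
    then have d: "degree p1 \<le> 2 * n" using deg \<open>\<beta> \<noteq> 0\<close> by (simp add: p1_def)
    have eq: "cnj z ^ Suc n * poly p z = of_real ((cmod (z - \<alpha>))\<^sup>2) * (cnj z ^ n * poly p1 z)"
      if "cmod z = 1" for z
    proof -
      have "z * cnj z = 1" using that by (simp add: complex_norm_square[symmetric])
      moreover have "\<beta> * cnj \<alpha> = 1" using \<open>\<alpha> \<noteq> 0\<close> by (simp add: \<beta>_def)
      ultimately have "cnj z * (z - \<beta>) = - \<beta> * cnj (z - \<alpha>)"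
        by (simp add: algebra_simps)
      then have "(z - \<alpha>) * (cnj z * (z - \<beta>)) * (cnj z ^ n * poly p2 z) =
          (z - \<alpha>) * (- \<beta> * cnj (z - \<alpha>)) * (cnj z ^ n * poly p2 z)" by simp
      then show ?thesis
        unfolding complex_norm_square by (simp add: p2 p1_def mult_ac del: mult_pCons_left mult_pCons_right)
    qed
    have "cnj z ^ n * poly p1 z \<in> \<real>\<^sub>\<ge>\<^sub>0" if z: "cmod z = 1" for z
    proof (rule closed_property_on_circle[where S = "{\<alpha>}" and f = "\<lambda>z. cnj z ^ n * poly p1 z"])
      fix z assume z: "cmod z = 1" "z \<notin> {\<alpha>}"
      have "cnj z ^ n * poly p1 z = of_real (inverse ((cmod (z - \<alpha>))\<^sup>2)) * (cnj z ^ Suc n * poly p z)"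
        using z by (subst eq) auto
      also have "\<dots> \<in> \<real>\<^sub>\<ge>\<^sub>0"
        by (rule nonneg_Reals_mult_I) (auto simp: Suc.prems(2) z simp del: power_Suc)
      finally show "cnj z ^ n * poly p1 z \<in> \<real>\<^sub>\<ge>\<^sub>0" .
    qed (use z in \<open>auto intro!: continuous_intros closed_nonneg_Reals_complex\<close>)
    from Suc.IH[OF d this] obtain A where A: "degree A \<le> n"
      "\<forall>z. cmod z = 1 \<longrightarrow> cnj z ^ n * poly p1 z = of_real ((cmod (poly A z))\<^sup>2)" by blast
    have "degree ([:-\<alpha>, 1:] * A) \<le> Suc n"
      using degree_mult_le[of "[:-\<alpha>, 1:]" A] A(1) by simp
    moreover have "cnj z ^ Suc n * poly p z = of_real ((cmod (poly ([:-\<alpha>, 1:] * A) z))\<^sup>2)"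
      if "cmod z = 1" for z
    proof -
      have "poly ([:-\<alpha>, 1:] * A) z = (z - \<alpha>) * poly A z" by (simp add: algebra_simps)
      then show ?thesis
        using A(2) that by (simp only: eq norm_mult power_mult_distrib of_real_mult)
    qed
    ultimately show ?thesis by blast
  qed
qed

subsection \<open>Spectral factorization of rational functions\<close>

lemma coprime_if_no_common_root:
  fixes p q :: "complex poly"
  assumes "\<And>z. poly p z = 0 \<Longrightarrow> poly q z \<noteq> 0"
  shows "coprime p q"
proof (rule coprimeI)
  fix c assume c: "c dvd p" "c dvd q"
  have "poly c z \<noteq> 0" for z
    using c assms by (metis dvdE mult_zero_left poly_mult)
  then have "degree c = 0" "c \<noteq> 0"
    using alg_closed_imp_poly_has_root[of c] by auto
  then show "is_unit c" by (simp add: is_unit_iff_degree)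
qed

lemma poly_split_roots:
  fixes q :: "'a::idom poly"
  assumes "q \<noteq> 0"
  shows "\<exists>q0 q1. q = q0 * q1 \<and> (\<forall>z. poly q0 z = 0 \<longrightarrow> R z) \<and> (\<forall>z. poly q1 z = 0 \<longrightarrow> \<not> R z)"
  using assms
proof (induction q rule: poly_root_induct[where P = R])
  case (no_roots q)
  then show ?case by (intro exI[of _ 1] exI[of _ q]) auto
next
  case (root a q)
  then have "q \<noteq> 0" by auto
  with root.IH obtain q0 q1 where "q = q0 * q1" "\<forall>z. poly q0 z = 0 \<longrightarrow> R z" "\<forall>z. poly q1 z = 0 \<longrightarrow> \<not> R z"
    by blast
  moreover from this(2) root.hyps have "\<forall>z. poly ([:a, -1:] * q0) z = 0 \<longrightarrow> R z"
    by auto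
  ultimately show ?case
    by (metis mult.assoc)
qed simp

lemma conj_reflect_mult:
  assumes "degree p \<le> m" "degree q \<le> n"
  shows "conj_reflect (m + n) (p * q) = conj_reflect m p * conj_reflect n q"
proof (rule poly_eq_if_eq_on_circle[of "{}"])
  have "degree (p * q) \<le> m + n"
    using degree_mult_le[of p q] assms by linarith
  then show "poly (conj_reflect (m + n) (p * q)) z = poly (conj_reflect m p * conj_reflect n q) z"
    if "cmod z = 1" for z
    using that assms by (simp add: poly_conj_reflect_circle power_add)
qed simp

text \<open>Realness on the circle is a polynomial identity between \<open>P\<close>,
  \<open>Q\<close> and their reversals. The zeros of \<open>Q\<close> outside the disc cannot cancel
  against their own mirror images, so they divide \<open>P\<close> times the reversal of
  \<open>Q0\<close>. The cofactor is a numerator of \<open>P / Q * |Q0|^2\<close>, to which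
  Fejer-Riesz applies.\<close>

lemma nonneg_rational_spectral_factor:
  fixes P Q :: "complex poly"
  assumes "P \<noteq> 0" and deg: "degree P < degree Q"
    and Q: "\<And>z. cmod z = 1 \<Longrightarrow> poly Q z \<noteq> 0"
    and nonneg: "\<And>z. cmod z = 1 \<Longrightarrow> poly P z / poly Q z \<in> \<real>\<^sub>\<ge>\<^sub>0"
  obtains A Q0 where "Q0 dvd Q" "\<And>z. poly Q0 z = 0 \<Longrightarrow> cmod z < 1" "degree A < degree Q0"
    "\<And>z. cmod z = 1 \<Longrightarrow> poly P z / poly Q z = of_real ((cmod (poly A z / poly Q0 z))\<^sup>2)"
proof -
  have "Q \<noteq> 0" using deg by auto
  then obtain Q0 Q1 where split: "Q = Q0 * Q1"
    and Q0: "\<And>z. poly Q0 z = 0 \<Longrightarrow> cmod z < 1" and Q1: "\<And>z. poly Q1 z = 0 \<Longrightarrow> \<not> cmod z < 1"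
    using poly_split_roots[of Q "\<lambda>z. cmod z < 1"] by blast
  have Q1': "cmod z > 1" if "poly Q1 z = 0" for z
    using Q1[OF that] Q[of z] that by (cases "cmod z = 1") (auto simp: split)
  define m d e where "m = degree Q" and "d = degree Q0" and "e = degree Q1"
  have nz: "Q0 \<noteq> 0" "Q1 \<noteq> 0" and m: "m = d + e"
    using \<open>Q \<noteq> 0\<close> by (auto simp: split m_def d_def e_def degree_mult_eq)
  define Q0' Q1' where "Q0' = conj_reflect d Q0" and "Q1' = conj_reflect e Q1"
  have Q': "conj_reflect m Q = Q0' * Q1'"
    by (simp add: m split Q0'_def Q1'_def conj_reflect_mult d_def e_def)
  \<comment> \<open>This is \<open>cnj (P / Q) = P / Q\<close> cleared of denominators and
    multiplied by \<open>z ^ m\<close>. As \<open>degree P < m\<close>, reversing \<open>P\<close>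
    at length \<open>m - 1\<close> exposes a factor \<open>z\<close>, which lowers the degree of the
    cofactor \<open>p\<close> by one.\<close>
  have "P * (Q0' * Q1') = [:0, 1:] * Q * conj_reflect (m - 1) P"
  proof (rule poly_eq_if_eq_on_circle[of "{}"])
    fix z :: complex assume z: "cmod z = 1"
    have "cnj (poly P z / poly Q z) = poly P z / poly Q z"
      using nonneg[OF z] by (metis Reals_cnj_iff nonneg_Reals_Real)
    then have eq: "poly P z * cnj (poly Q z) = poly Q z * cnj (poly P z)"
      using Q[OF z] by (simp add: field_simps)
    have "degree P \<le> m - 1" "m > 0" using deg by (auto simp: m_def)
    then have "poly (P * (Q0' * Q1')) z = z ^ m * (poly P z * cnj (poly Q z))"
      using z by (simp flip: Q' add: poly_conj_reflect_circle m_def)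
    also have "\<dots> = z * z ^ (m - 1) * (poly Q z * cnj (poly P z))"
      using \<open>m > 0\<close> by (simp add: eq power_eq_if)
    also have "\<dots> = poly ([:0, 1:] * Q * conj_reflect (m - 1) P) z"
      using z \<open>degree P \<le> m - 1\<close> by (simp add: poly_conj_reflect_circle)
    finally show "poly (P * (Q0' * Q1')) z = poly ([:0, 1:] * Q * conj_reflect (m - 1) P) z" .
  qed simp
  then have "(P * Q0') * Q1' = ([:0, 1:] * Q1) * (Q0 * conj_reflect (m - 1) P)"
    by (simp only: split mult_ac)
  then have "[:0, 1:] * Q1 dvd (P * Q0') * Q1'"
    by (metis dvd_triv_left)
  \<comment> \<open>Zeros of \<open>Q1\<close> lie outside the closed disc, so nonzero zeros of
    \<open>Q1'\<close> lie inside; at 0, \<open>Q1'\<close> takes the conjugate leading coefficient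
    of \<open>Q1\<close>.\<close>
  moreover have "coprime ([:0, 1:] * Q1) Q1'"
  proof (rule coprime_if_no_common_root)
    fix z assume "poly ([:0, 1:] * Q1) z = 0"
    then consider "z = 0" | "z \<noteq> 0" "poly Q1 z = 0" by auto
    then show "poly Q1' z \<noteq> 0"
    proof cases
      case 1
      then show ?thesis using nz by (simp add: Q1'_def poly_0_coeff_0 coeff_conj_reflect e_def)
    next
      case 2
      then have "cmod (inverse (cnj z)) < 1"
        using Q1' by (auto simp: norm_inverse inverse_less_1_iff)
      then have "poly Q1 (inverse (cnj z)) \<noteq> 0" using Q1 by blast
      then show ?thesis using 2 by (simp add: Q1'_def poly_conj_reflect e_def)
    qed
  qed
  ultimately have "[:0, 1:] * Q1 dvd P * Q0'"
    using coprime_dvd_mult_left_iff by blast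
  then obtain p where p: "P * Q0' = [:0, 1:] * Q1 * p" by (elim dvdE)
  have "Q0' \<noteq> 0"
  proof
    assume "Q0' = 0"
    then have "coeff Q0' 0 = 0" by simp
    then show False using nz by (simp add: Q0'_def coeff_conj_reflect d_def)
  qed
  then have "p \<noteq> 0" using \<open>P \<noteq> 0\<close> p by auto
  \<comment> \<open>Comparing degrees, \<open>1 + e + degree p < m + d = 2 * d + e\<close>. Hence
    \<open>degree p \<le> 2 * d - 2\<close> and \<open>d > 0\<close>, so \<open>d - 1\<close> is not
    truncated.\<close>
  have "degree (P * Q0') = Suc (e + degree p)"
    unfolding p using nz \<open>p \<noteq> 0\<close> by (simp add: degree_mult_eq e_def del: mult_pCons_left)
  moreover have "degree Q0' \<le> d" by (simp add: Q0'_def degree_conj_reflect_le)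
  ultimately have "Suc (e + degree p) < m + d"
    using deg degree_mult_le[of P Q0'] by (simp add: m_def)
  then have dp: "degree p \<le> 2 * (d - 1)" "d > 0" by (auto simp: m)
  \<comment> \<open>On the circle \<open>Q0'\<close> is \<open>z ^ d * cnj Q0\<close>; multiply
    \<open>P * Q0' = z * Q1 * p\<close> by \<open>cnj z ^ d\<close> and divide by
    \<open>Q1\<close>.\<close>
  have key: "cnj z ^ (d - 1) * poly p z = poly P z / poly Q z * of_real ((cmod (poly Q0 z))\<^sup>2)"
    if z: "cmod z = 1" for z
  proof -
    have zz: "z * cnj z = 1" using z by (simp add: complex_norm_square[symmetric])
    have "poly P z * (z ^ d * cnj (poly Q0 z)) = z * poly Q1 z * poly p z"
      using arg_cong[OF p, of "\<lambda>q. poly q z"] z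
      by (simp add: Q0'_def poly_conj_reflect_circle d_def)
    then have "cnj z ^ d * (poly P z * (z ^ d * cnj (poly Q0 z))) = cnj z ^ d * (z * poly Q1 z * poly p z)"
      by simp
    moreover have "cnj z ^ d * z ^ d = 1" by (metis zz mult.commute power_mult_distrib power_one)
    moreover have "cnj z ^ d * z = cnj z ^ (d - 1)"
      using zz \<open>d > 0\<close> by (cases d) (auto simp: mult_ac)
    ultimately have "poly P z * cnj (poly Q0 z) = cnj z ^ (d - 1) * poly p z * poly Q1 z"
      by (metis (no_types, lifting) mult.assoc mult.commute mult_1)
    moreover have "poly Q0 z \<noteq> 0" "poly Q1 z \<noteq> 0" using Q[OF z] by (auto simp: split)
    ultimately show ?thesis
      by (simp add: split complex_norm_square field_simps del: of_real_power)
  qed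
  have "cnj z ^ (d - 1) * poly p z \<in> \<real>\<^sub>\<ge>\<^sub>0" if "cmod z = 1" for z
    unfolding key[OF that] by (intro nonneg_Reals_mult_I nonneg[OF that]) auto
  from Fejer_Riesz[OF dp(1) this] obtain A where A: "degree A \<le> d - 1"
    "\<And>z. cmod z = 1 \<Longrightarrow> cnj z ^ (d - 1) * poly p z = of_real ((cmod (poly A z))\<^sup>2)" by blast
  show thesis
  proof (rule that[of Q0 A])
    show "Q0 dvd Q" by (simp add: split)
    show "degree A < degree Q0" using A(1) \<open>d > 0\<close> by (simp add: d_def)
    show "poly P z / poly Q z = of_real ((cmod (poly A z / poly Q0 z))\<^sup>2)" if z: "cmod z = 1" for z
    proof -
      have "poly Q0 z \<noteq> 0" using Q[OF z] by (auto simp: split)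
      then show ?thesis
        using key[OF z] A(2)[OF z] by (simp add: norm_divide power_divide field_simps)
    qed
  qed (use Q0 in auto)
qed

section \<open>Expansion at infinity and its linear recurrence\<close>

text \<open>With \<open>w = 1 / z\<close>, which is \<open>cnj z\<close> on the circle,
  \<open>A / Q\<close> becomes \<open>w * B w / D w\<close>: \<open>D\<close> is the reversal of
  \<open>Q\<close>, and the monomial makes \<open>B\<close> the reversal of \<open>A\<close> at
  length \<open>degree Q - 1\<close>. The zeros of \<open>D\<close> lie outside the closed
  disc.\<close>

lemma rational_power_series_at_infinity:
  fixes A Q :: "complex poly"
  assumes deg: "degree A < degree Q" and roots: "\<And>z. poly Q z = 0 \<Longrightarrow> cmod z < 1"
  obtains f where "fps_conv_radius f > 1"
    "\<And>z. cmod z = 1 \<Longrightarrow> poly A z / poly Q z = cnj z * eval_fps f (cnj z)"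
    "f * fps_of_poly (reflect_poly Q) = fps_of_poly (monom 1 (degree Q - 1 - degree A) * reflect_poly A)"
proof -
  define B where "B = monom 1 (degree Q - 1 - degree A) * reflect_poly A"
  define D where "D = reflect_poly Q"
  have "Q \<noteq> 0" using deg by auto
  then have D0: "poly D 0 \<noteq> 0" and "D \<noteq> 0" by (auto simp: D_def)
  have D: "cmod w > 1" if "poly D w = 0" for w
  proof -
    have "w \<noteq> 0" using that D0 by auto
    then have "poly Q (inverse w) = 0" using that by (simp add: D_def poly_reflect_poly_nz)
    from roots[OF this] show ?thesis using \<open>w \<noteq> 0\<close> by (simp add: norm_inverse inverse_less_1_iff)
  qed
  \<comment> \<open>The 2 keeps the minimum defined when \<open>D\<close> has no zeros, as for
    \<open>Q\<close> a power of \<open>z\<close>.\<close>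
  define r where "r = Min (insert 2 (cmod ` {w. poly D w = 0}))"
  have fin: "finite (insert 2 (cmod ` {w. poly D w = 0}))" using poly_roots_finite[OF \<open>D \<noteq> 0\<close>] by simp
  then have "r > 1" using D by (auto simp: r_def)
  have nz: "eval_fps (fps_of_poly D) w \<noteq> 0" if "w \<in> eball 0 (ereal r)" for w
  proof
    assume "eval_fps (fps_of_poly D) w = 0"
    then have "r \<le> cmod w" unfolding r_def by (intro Min_le fin) auto
    with that show False by simp
  qed
  define f where "f = fps_of_poly B / fps_of_poly D"
  have "ereal r \<le> fps_conv_radius f"
    unfolding f_def using fps_conv_radius_divide'[of "fps_of_poly B" "fps_of_poly D" "ereal r"] nz \<open>r > 1\<close>
    by simp
  then have rad: "fps_conv_radius f > 1" using \<open>r > 1\<close>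
    by (metis ereal_less(3) less_le_trans one_ereal_def ereal_less_eq(3) less_ereal.simps(1))
  have fD: "f * fps_of_poly D = fps_of_poly B"
    unfolding f_def using D0 by (intro dvd_div_mult_self) (auto simp: poly_0_coeff_0 intro: unit_imp_dvd)
  have val: "poly A z / poly Q z = cnj z * eval_fps f (cnj z)" if z: "cmod z = 1" for z
  proof -
    have z': "inverse (cnj z) = z" "cnj z \<noteq> 0" using z by (auto simp: cnj_eq_inverse_on_circle)
    have "eval_fps f (cnj z) = poly B (cnj z) / poly D (cnj z)"
      unfolding f_def using z \<open>r > 1\<close> nz
      by (subst eval_fps_divide'[where r = "ereal r"]) auto
    moreover have "poly B (cnj z) = cnj z ^ (degree Q - 1) * poly A z"
      using z' deg by (simp add: B_def poly_monom poly_reflect_poly_nz flip: power_add mult.assoc)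
    moreover have "poly D (cnj z) = cnj z ^ (degree Q) * poly Q z"
      using z' by (simp add: D_def poly_reflect_poly_nz)
    moreover have "cnj z ^ degree Q = cnj z * cnj z ^ (degree Q - 1)" 
      using deg by (simp add: power_eq_if)
    ultimately show ?thesis using z' by simp
  qed
  show thesis using that[OF rad val] fD by (simp add: B_def D_def)
qed

text \<open>The sum is the coefficient of order \<open>n + degree Q\<close> of the product, beyond
  the degree of \<open>B\<close>. It is the equation for the kernel of \<open>Q\<close> applied to
  the backward shift.\<close>

lemma fps_quotient_recurrence:
  fixes Q :: "'a::idom poly"
  assumes "f * fps_of_poly (reflect_poly Q) = fps_of_poly B" "degree B < degree Q"
  shows "(\<Sum>i\<le>degree Q. coeff Q i * fps_nth f (n + i)) = 0"
proof -
  have "0 = fps_nth (f * fps_of_poly (reflect_poly Q)) (n + degree Q)"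
    using assms by (simp add: coeff_eq_0)
  also have "\<dots> = (\<Sum>i\<le>n + degree Q. fps_nth f i * coeff (reflect_poly Q) (n + degree Q - i))"
    by (simp add: fps_mult_nth atMost_atLeast0)
  also have "\<dots> = (\<Sum>i\<in>{n..n + degree Q}. fps_nth f i * coeff (reflect_poly Q) (n + degree Q - i))"
    by (rule sum.mono_neutral_right) (auto simp: coeff_reflect_poly)
  also have "\<dots> = (\<Sum>i\<le>degree Q. coeff Q i * fps_nth f (n + i))"
    by (rule sum.reindex_bij_witness[of _ "\<lambda>i. n + i" "\<lambda>i. i - n"])
       (auto simp: coeff_reflect_poly)
  finally show ?thesis ..
qed

subsection \<open>Fourier coefficients of a squared modulus\<close>

lemma integral_suminf_uniform:
  fixes f :: "nat \<Rightarrow> real \<Rightarrow> complex"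
  assumes "\<And>n. continuous_on {a..b} (f n)"
    and "\<And>n t. t \<in> {a..b} \<Longrightarrow> norm (f n t) \<le> M n" and "summable M"
  shows "(\<lambda>n. integral {a..b} (f n)) sums integral {a..b} (\<lambda>t. \<Sum>n. f n t)"
proof -
  have "uniform_limit {a..b} (\<lambda>n t. \<Sum>i<n. f i t) (\<lambda>t. \<Sum>i. f i t) sequentially"
    using assms(2,3) by (rule Weierstrass_m_test)
  then obtain I J where "\<And>n. ((\<lambda>t. \<Sum>i<n. f i t) has_integral I n) {a..b}"
    "((\<lambda>t. \<Sum>i. f i t) has_integral J) {a..b}" "I \<longlonglongrightarrow> J"
    by (rule uniform_limit_integral) (auto intro!: continuous_intros assms(1))
  moreover have "((\<lambda>t. \<Sum>i<n. f i t) has_integral (\<Sum>i<n. integral {a..b} (f i))) {a..b}" for n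
    by (intro has_integral_sum integrable_integral integrable_continuous_real assms(1)) auto
  ultimately have "I = (\<lambda>n. \<Sum>i<n. integral {a..b} (f i))" "I \<longlonglongrightarrow> J"
    "((\<lambda>t. \<Sum>i. f i t) has_integral J) {a..b}"
    by (auto intro: has_integral_unique)
  then show ?thesis
    by (simp add: sums_def integral_unique)
qed

lemma integral_exp_int_period:
  "integral {0..2 * pi} (\<lambda>t. exp (\<i> * of_int j * of_real t)) = (if j = 0 then 2 * of_real pi else 0)"
proof (cases "j = 0")
  case False
  have "((\<lambda>t. exp (\<i> * of_int j * of_real t)) has_integral
      (exp (\<i> * of_int j * of_real (2 * pi)) / (\<i> * of_int j) - exp (\<i> * of_int j * of_real 0) / (\<i> * of_int j))) {0..2 * pi}"
  proof (rule fundamental_theorem_of_calculus)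
    fix t
    have deriv: "((\<lambda>w. exp (c * w) / c) has_field_derivative exp (c * z)) (at z)" if "c \<noteq> 0" for c z :: complex
      using that by (auto intro!: derivative_eq_intros)
    have "\<i> * of_int j \<noteq> 0" using False by simp
    from deriv[OF this] show "((\<lambda>t. exp (\<i> * of_int j * of_real t) / (\<i> * of_int j)) has_vector_derivative
        exp (\<i> * of_int j * of_real t)) (at t within {0..2 * pi})"
      by (rule has_vector_derivative_at_within[OF has_vector_derivative_real_field])
  qed simp
  moreover have "exp (\<i> * of_int j * of_real (2 * pi)) = 1"
    unfolding exp_eq_1 by (auto intro!: exI[of _ j])
  ultimately have "((\<lambda>t. exp (\<i> * of_int j * of_real t)) has_integral 0) {0..2 * pi}"
    by (simp only: of_real_0 mult_zero_right exp_zero diff_self)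
  with False show ?thesis by (simp only: integral_unique if_False)
qed (simp add: scaleR_conv_of_real)

text \<open>In \<open>U * cnj U\<close> the series for \<open>U\<close> is integrated termwise, then
  that for \<open>cnj U\<close>, and orthogonality of the exponentials leaves one term. Absolute
  summability gives uniform convergence both times.\<close>

lemma circle_coeff_norm_square_power_series:
  fixes a :: "nat \<Rightarrow> complex"
  assumes a: "summable (\<lambda>n. cmod (a n))"
  shows "(\<lambda>n. a n * cnj (a (n + k))) sums
    circle_coeff (\<lambda>z. of_real ((cmod (\<Sum>n. a n * cnj z ^ n))\<^sup>2)) k"
proof -
  define e :: "int \<Rightarrow> real \<Rightarrow> complex" where "e j t = exp (\<i> * of_int j * of_real t)" for j t
  have e_cont: "continuous_on S (e j)" for S j
    unfolding e_def by (intro continuous_intros)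
  have e_norm: "cmod (e j t) = 1" for j t
    by (simp add: e_def)
  have e_add: "e i t * e j t = e (i + j) t" for i j t
    by (simp add: e_def algebra_simps flip: exp_add)
  have e_cnj: "cnj (e j t) = e (- j) t" for j t
    by (simp add: e_def exp_cnj)
  define U where "U t = (\<Sum>n. a n * e (- int n) t)" for t
  have sU: "summable (\<lambda>n. a n * e (- int n) t)" for t
    by (rule summable_norm_cancel) (use a in \<open>simp add: norm_mult e_norm\<close>)
  \<comment> \<open>The terms of the outer series contain \<open>cnj U\<close>, so termwise
    integration requires its continuity and a bound.\<close>
  have "continuous_on {0..2 * pi} U"
  proof (rule uniform_limit_theorem)
    show "uniform_limit {0..2 * pi} (\<lambda>N t. \<Sum>n<N. a n * e (- int n) t) U sequentially"
      unfolding U_def[abs_def] by (rule Weierstrass_m_test[OF _ a]) (simp add: norm_mult e_norm)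
  qed (auto intro!: continuous_intros e_cont always_eventually)
  have U_norm: "cmod (U t) \<le> (\<Sum>n. cmod (a n))" for t
    using summable_norm[of "\<lambda>n. a n * e (- int n) t"] a unfolding U_def by (simp add: norm_mult e_norm)
  have inner: "integral {0..2 * pi} (\<lambda>t. cnj (U t) * e j t) = (if j \<le> 0 then 2 * of_real pi * cnj (a (nat (- j))) else 0)" for j
  proof -
    have "(\<lambda>m. integral {0..2 * pi} (\<lambda>t. cnj (a m) * e (int m + j) t)) sums
        integral {0..2 * pi} (\<lambda>t. \<Sum>m. cnj (a m) * e (int m + j) t)"
      by (rule integral_suminf_uniform[OF _ _ a])
         (auto intro!: continuous_intros e_cont simp: norm_mult e_norm)
    \<comment> \<open>Only \<open>m = - j\<close> contributes. For \<open>j > 0\<close> there is no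
      such \<open>m\<close>: \<open>nat (- j)\<close> is then 0 and the inner conditional gives
      0.\<close>
    moreover have "(\<lambda>m. integral {0..2 * pi} (\<lambda>t. cnj (a m) * e (int m + j) t)) =
       (\<lambda>m. if m = nat (- j) then if j \<le> 0 then 2 * of_real pi * cnj (a (nat (- j))) else 0 else 0)"
      unfolding e_def integral_mult_right integral_exp_int_period by (auto simp: fun_eq_iff)
    moreover have "(\<Sum>m. cnj (a m) * e (int m + j) t) = cnj (U t) * e j t" for t
    proof -
      have "(\<lambda>m. cnj (a m * e (- int m) t) * e j t) sums (cnj (U t) * e j t)"
        unfolding U_def by (intro sums_mult2 sums_cnj[THEN iffD2] summable_sums sU)
      then show ?thesis by (simp add: sums_iff e_cnj e_add mult.assoc)
    qed
    ultimately show ?thesis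
      using sums_unique2[OF _ sums_single[of "nat (- j)" "\<lambda>_. if j \<le> 0 then 2 * of_real pi * cnj (a (nat (- j))) else 0"]]
      by simp
  qed
  have "(\<lambda>n. integral {0..2 * pi} (\<lambda>t. a n * (cnj (U t) * e (- int n - int k) t))) sums
      integral {0..2 * pi} (\<lambda>t. \<Sum>n. a n * (cnj (U t) * e (- int n - int k) t))"
    by (rule integral_suminf_uniform[where M = "\<lambda>n. cmod (a n) * (\<Sum>n. cmod (a n))"])
       (use U_norm a \<open>continuous_on {0..2 * pi} U\<close> in \<open>auto intro!: continuous_intros e_cont mult_left_mono
         simp: norm_mult e_norm summable_mult2\<close>)
  moreover have "(\<Sum>n. a n * (cnj (U t) * e (- int n - int k) t)) = of_real ((cmod (U t))\<^sup>2) * e (- int k) t" for t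
  proof -
    have "(\<lambda>n. a n * e (- int n) t * (cnj (U t) * e (- int k) t)) sums (U t * (cnj (U t) * e (- int k) t))"
      unfolding U_def by (intro sums_mult2 summable_sums sU)
    then have "(\<lambda>n. a n * (cnj (U t) * (e (- int n) t * e (- int k) t))) sums (U t * cnj (U t) * e (- int k) t)"
      by (simp add: mult_ac)
    then show ?thesis by (simp only: complex_norm_square e_add sums_iff) simp
  qed
  ultimately have "(\<lambda>n. a n * (2 * of_real pi * cnj (a (n + k)))) sums
      integral {0..2 * pi} (\<lambda>t. of_real ((cmod (U t))\<^sup>2) * e (- int k) t)"
    by (simp add: inner nat_add_distrib add.commute[of k])
  then have "(\<lambda>n. 1 / (2 * of_real pi) * (a n * (2 * of_real pi * cnj (a (n + k))))) sums
      (1 / (2 * of_real pi) * integral {0..2 * pi} (\<lambda>t. of_real ((cmod (U t))\<^sup>2) * e (- int k) t))"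
    by (rule sums_mult)
  moreover have "(\<Sum>n. a n * cnj (exp (\<i> * of_real t)) ^ n) = U t" for t
    by (simp add: U_def e_def exp_cnj algebra_simps flip: exp_of_nat_mult)
  moreover have "e (- int k) t = exp (- \<i> * of_nat k * of_real t)" for t
    by (simp add: e_def)
  moreover have "1 / (2 * of_real pi) * (a n * (2 * of_real pi * cnj (a (n + k)))) = a n * cnj (a (n + k))" for n
    by simp
  ultimately show ?thesis
    by (simp only: circle_coeff_def)
qed

section \<open>Finite exceptional sets on the circle\<close>

lemma finite_circle_parameters:
  assumes "finite S"
  shows "finite {t \<in> {0..2 * pi}. exp (\<i> * of_real t) \<in> S}"
proof -
  have "inj_on (\<lambda>t. exp (\<i> * of_real t)) {0<..<2 * pi}"
  proof (rule inj_onI)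
    fix s t assume st: "s \<in> {0<..<2 * pi}" "t \<in> {0<..<2 * pi}" "exp (\<i> * of_real s) = exp (\<i> * of_real t)"
    then obtain n :: int where "\<i> * of_real s = \<i> * of_real t + (of_int (2 * n) * pi) * \<i>"
      by (auto simp: exp_eq)
    then have "s = t + 2 * of_int n * pi"
      by (auto simp: complex_eq_iff)
    moreover have "n = 0"
    proof -
      have "of_int n * (2 * pi) < 1 * (2 * pi)" "- 1 * (2 * pi) < of_int n * (2 * pi)"
        using st \<open>s = t + 2 * of_int n * pi\<close> unfolding greaterThanLessThan_iff by linarith+
      then have "of_int n < (1 :: real)" "- 1 < (of_int n :: real)"
        by (simp_all only: mult_less_cancel_right_pos[of "2 * pi"] mult_pos_pos pi_gt_zero zero_less_numeral)
      then show ?thesis by linarith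
    qed
    ultimately show "s = t" by simp
  qed
  then have "finite ((\<lambda>t. exp (\<i> * of_real t)) -` S \<inter> {0<..<2 * pi})"
    by (rule finite_vimage_IntI[OF \<open>finite S\<close>])
  then have "finite (insert 0 (insert (2 * pi) ((\<lambda>t. exp (\<i> * of_real t)) -` S \<inter> {0<..<2 * pi})))"
    by simp
  then show ?thesis by (rule finite_subset[rotated]) fastforce
qed

text \<open>Finitely many parameters form a negligible set. The exceptional points in the
  application are the common zeros of \<open>P\<close> and \<open>Q\<close>.\<close>

lemma circle_coeff_cong:
  assumes "finite S" "\<And>z. cmod z = 1 \<Longrightarrow> z \<notin> S \<Longrightarrow> F z = G z"
  shows "circle_coeff F k = circle_coeff G k"
proof -
  have "integral {0..2 * pi} (\<lambda>t. F (exp (\<i> * of_real t)) * exp (- \<i> * of_nat k * of_real t)) =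
    integral {0..2 * pi} (\<lambda>t. G (exp (\<i> * of_real t)) * exp (- \<i> * of_nat k * of_real t))"
    by (rule integral_spike[OF negligible_finite[OF finite_circle_parameters[OF assms(1)]]])
       (auto simp: assms(2))
  then show ?thesis by (simp add: circle_coeff_def)
qed

subsection \<open>The numerical radius\<close>

lemma backward_shift_power: "(backward_shift ^^ k) x n = x (n + k)"
  by (induction k arbitrary: n) (auto simp: backward_shift_def)

lemma cmod_mult_cnj_le: "cmod (u * cnj v) \<le> ((cmod u)\<^sup>2 + (cmod v)\<^sup>2) / 2"
  using sum_squares_bound[of "cmod u" "cmod v"] by (simp add: norm_mult)

lemma summable_shift_inner:
  assumes "summable (\<lambda>n. (cmod (x n))\<^sup>2)"
  shows "summable (\<lambda>n. cmod (x (n + k) * cnj (x n)))"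
proof (rule summable_comparison_test)
  have "summable (\<lambda>n. (cmod (x (n + k)))\<^sup>2)"
    using assms by (subst summable_iff_shift)
  with assms show "summable (\<lambda>n. ((cmod (x (n + k)))\<^sup>2 + (cmod (x n))\<^sup>2) / 2)"
    by (intro summable_divide summable_add)
qed (use cmod_mult_cnj_le in auto)

text \<open>The bound 1 follows from \<open>|u v| \<le> (|u|^2 + |v|^2) / 2\<close>, as dropping
  initial terms does not increase the norm. It is needed to compare values with the real
  supremum.\<close>

lemma numerical_radius_bdd_above:
  "bdd_above {cmod (ell2_inner ((restricted_shift Q ^^ k) x) x) | x. x \<in> ker_shift Q \<and> ell2_norm x = 1}"
proof (rule bdd_aboveI[of _ 1])
  fix r assume "r \<in> {cmod (ell2_inner ((restricted_shift Q ^^ k) x) x) | x. x \<in> ker_shift Q \<and> ell2_norm x = 1}"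
  then obtain x where x: "x \<in> ker_shift Q" "ell2_norm x = 1"
    and r: "r = cmod (\<Sum>n. x (n + k) * cnj (x n))"
    by (auto simp: ell2_inner_def restricted_shift_power backward_shift_power)
  define s where "s n = (cmod (x n))\<^sup>2" for n
  have s: "summable s" "suminf s = 1"
    using x by (auto simp: s_def[abs_def] ker_shift_def ell2_def ell2_norm_def)
  have sk: "summable (\<lambda>n. s (n + k))"
    using s(1) by simp
  have "(\<Sum>n. s (n + k)) \<le> 1"
    using suminf_split_initial_segment[OF s(1), of k] s(2) sum_nonneg[of "{..<k}" s] by (simp add: s_def)
  note le = cmod_mult_cnj_le[of "x (n + k)" "x n" for n, folded s_def]
  have sum: "summable (\<lambda>n. (s (n + k) + s n) / 2)"
    by (intro summable_divide summable_add s sk)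
  have nsum: "summable (\<lambda>n. cmod (x (n + k) * cnj (x n)))"
    using s(1) unfolding s_def by (rule summable_shift_inner)
  have "r \<le> (\<Sum>n. cmod (x (n + k) * cnj (x n)))"
    unfolding r by (rule summable_norm[OF nsum])
  also have "\<dots> \<le> (\<Sum>n. (s (n + k) + s n) / 2)"
    by (rule suminf_le[OF le nsum sum])
  also have "\<dots> = ((\<Sum>n. s (n + k)) + suminf s) / 2"
    using suminf_divide[OF summable_add[OF sk s(1)]] suminf_add[OF sk s(1)] by simp
  also have "\<dots> \<le> 1" using s(2) \<open>(\<Sum>n. s (n + k)) \<le> 1\<close> by simp
  finally show "r \<le> 1" .
qed

lemma ell2_inner_le_numerical_radius:
  assumes x: "x \<in> ker_shift Q"
  shows "cmod (ell2_inner ((restricted_shift Q ^^ k) x) x) \<le>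
    (ell2_norm x)\<^sup>2 * numerical_radius (ker_shift Q) (restricted_shift Q ^^ k)"
proof -
  have sum: "summable (\<lambda>n. (cmod (x n))\<^sup>2)" 
    and ker: "\<And>n. (\<Sum>i\<le>degree Q. coeff Q i * x (n + i)) = 0"
    using x by (auto simp: ker_shift_def ell2_def poly_op_def backward_shift_power fun_eq_iff)
  have nonneg: "(\<Sum>n. (cmod (x n))\<^sup>2) \<ge> 0" by (rule suminf_nonneg[OF sum]) auto
  define N where "N = ell2_norm x"
  have N2: "N\<^sup>2 = (\<Sum>n. (cmod (x n))\<^sup>2)" using nonneg by (simp add: N_def ell2_norm_def)
  show ?thesis
  proof (cases "N = 0")
    \<comment> \<open>Both sides vanish, whatever the value of the numerical radius; it is
      unspecified when the kernel is \<open>{0}\<close>.\<close>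
    case True
    then have "x = (\<lambda>n. 0)" using suminf_eq_zero_iff[OF sum] N2 by auto
    then show ?thesis by (simp add: restricted_shift_power[OF x] ell2_inner_def backward_shift_power ell2_norm_def)
  next
    case False
    define y where "y n = x n / of_real N" for n
    have y: "y \<in> ker_shift Q"
      using sum ker unfolding ker_shift_def ell2_def poly_op_def
      by (simp add: y_def[abs_def] norm_divide power_divide summable_divide backward_shift_power flip: sum_divide_distrib)
    have "ell2_norm y = 1"
      using False sum by (simp add: ell2_norm_def y_def norm_divide power_divide suminf_divide flip: N2)
    with y have "cmod (ell2_inner ((restricted_shift Q ^^ k) y) y) \<le> numerical_radius (ker_shift Q) (restricted_shift Q ^^ k)"
      unfolding numerical_radius_def by (intro cSup_upper numerical_radius_bdd_above) auto
    moreover have "ell2_inner ((restricted_shift Q ^^ k) y) y = ell2_inner ((restricted_shift Q ^^ k) x) x / (of_real N)\<^sup>2"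
    proof -
      have "summable (\<lambda>n. x (n + k) * cnj (x n))"
        by (rule summable_norm_cancel) (rule summable_shift_inner[OF sum])
      from suminf_divide[OF this, of "(of_real N)\<^sup>2"] show ?thesis
        by (simp add: restricted_shift_power x y ell2_inner_def backward_shift_power y_def power2_eq_square)
    qed
    ultimately have "cmod (ell2_inner ((restricted_shift Q ^^ k) x) x) / N\<^sup>2 \<le>
        numerical_radius (ker_shift Q) (restricted_shift Q ^^ k)"
      by (simp add: norm_divide norm_power)
    with False show ?thesis
      by (simp add: N_def[symmetric] pos_divide_le_eq mult.commute)
  qed
qed

section \<open>Poles of rational functions and assembly of the proof\<close>

lemma is_pole_rational:
  fixes P Q :: "complex poly"
  assumes "poly Q z = 0" "poly P z \<noteq> 0" "Q \<noteq> 0"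
  shows "is_pole (\<lambda>w. poly P w / poly Q w) z"
  unfolding is_pole_def
proof (rule filterlim_divide_at_infinity)
  show "((\<lambda>w. poly P w) \<longlongrightarrow> poly P z) (at z)"
    by (intro tendsto_intros)
  have "\<forall>\<^sub>F w in at z. poly Q w \<noteq> 0"
    using islimpt_finite[OF poly_roots_finite[OF \<open>Q \<noteq> 0\<close>], of z]
    by (simp add: islimpt_iff_eventually)
  moreover have "((\<lambda>w. poly Q w) \<longlongrightarrow> poly Q z) (at z)"
    by (intro tendsto_intros)
  ultimately show "filterlim (\<lambda>w. poly Q w) (at 0) (at z)"
    using assms(1) by (simp add: filterlim_at)
qed (use assms in auto)

lemma summable_square_if_summable:
  fixes f :: "nat \<Rightarrow> real"
  assumes "summable f" "\<And>n. f n \<ge> 0"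
  shows "summable (\<lambda>n. (f n)\<^sup>2)"
proof (rule summable_comparison_test_ev)
  have "\<forall>\<^sub>F n in sequentially. f n < 1"
    using summable_LIMSEQ_zero[OF assms(1)] by (rule order_tendstoD) simp
  then show "\<forall>\<^sub>F n in sequentially. norm ((f n)\<^sup>2) \<le> f n"
    by eventually_elim (use assms(2) in \<open>simp add: power2_eq_square mult_left_le\<close>)
qed (fact assms(1))

theorem theorem5p1:
  fixes P Q :: "complex poly" and F :: "complex \<Rightarrow> complex" and k :: nat
  assumes "Q \<noteq> 0"
    and "P = 0 \<or> degree P < degree Q"
    and "F = (\<lambda>z. poly P z / poly Q z)"
    and "\<And>\<zeta>. cmod \<zeta> = 1 \<Longrightarrow> \<not> is_pole F \<zeta>"
    and "\<And>\<zeta>. cmod \<zeta> = 1 \<Longrightarrow> F \<zeta> \<in> \<real>\<^sub>\<ge>\<^sub>0"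
  shows "cmod (circle_coeff F k) \<le>
    Re (circle_coeff F 0) * numerical_radius (ker_shift Q) (restricted_shift Q ^^ k)"
proof (cases "P = 0")
  \<comment> \<open>Both Fourier coefficients are 0, so the value of the numerical radius does not
    matter.\<close>
  case True
  then show ?thesis by (simp add: assms(3) circle_coeff_def)
next
  case False
  have "gcd P Q \<noteq> 0" using assms(1) by simp
  then obtain P1 Q1 where PQ: "P = P1 * gcd P Q" "Q = Q1 * gcd P Q" and cop: "coprime P1 Q1"
    using gcd_coprime_exists by blast
  \<comment> \<open>On \<open>S\<close> the function \<open>F\<close> is 0 by the convention for
    division, so it can differ from the reduced fraction.\<close>
  define S where "S = {z. poly (gcd P Q) z = 0}"
  have "finite S" unfolding S_def using \<open>gcd P Q \<noteq> 0\<close> by (rule poly_roots_finite)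
  have "P1 \<noteq> 0" "Q1 \<noteq> 0" using False assms(1) PQ by auto
  have "degree P = degree P1 + degree (gcd P Q)" "degree Q = degree Q1 + degree (gcd P Q)"
    by (metis PQ(1) \<open>P1 \<noteq> 0\<close> \<open>gcd P Q \<noteq> 0\<close> degree_mult_eq)
       (metis PQ(2) \<open>Q1 \<noteq> 0\<close> \<open>gcd P Q \<noteq> 0\<close> degree_mult_eq)
  then have deg: "degree P1 < degree Q1" using assms(2) False by auto
  have F_eq: "F z = poly P1 z / poly Q1 z" if "z \<notin> S" for z
  proof -
    have "poly P z = poly P1 z * poly (gcd P Q) z" "poly Q z = poly Q1 z * poly (gcd P Q) z"
      by (metis PQ poly_mult)+
    with that show ?thesis by (simp add: assms(3) S_def)
  qed
  \<comment> \<open>By coprimality such a zero is a pole of the reduced fraction, hence of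
    \<open>F\<close>, since the two agree on a punctured neighbourhood.\<close>
  have Q1_circle: "poly Q1 z \<noteq> 0" if z: "cmod z = 1" for z
  proof
    assume "poly Q1 z = 0"
    moreover from this have "poly P1 z \<noteq> 0" using coprime_poly_0[OF cop, of z] by simp
    ultimately have "is_pole (\<lambda>w. poly P1 w / poly Q1 w) z"
      using is_pole_rational \<open>Q1 \<noteq> 0\<close> by blast
    moreover have "\<forall>\<^sub>F w in at z. w \<notin> S"
      using islimpt_finite[OF \<open>finite S\<close>, of z] by (simp add: islimpt_iff_eventually)
    then have "\<forall>\<^sub>F w in at z. poly P1 w / poly Q1 w = F w"
      by eventually_elim (simp add: F_eq)
    then have "is_pole (\<lambda>w. poly P1 w / poly Q1 w) z \<longleftrightarrow> is_pole F z"
      by (rule is_pole_cong) (rule refl)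
    ultimately have "is_pole F z" by blast
    with assms(4)[OF z] show False by simp
  qed
  have nonneg: "poly P1 z / poly Q1 z \<in> \<real>\<^sub>\<ge>\<^sub>0" if "cmod z = 1" for z
  proof -
    \<comment> \<open>On \<open>S\<close> the sign of the reduced fraction comes by closedness. For
      this it is multiplied by \<open>|Q1|^2\<close>, which makes \<open>h\<close> continuous on the
      whole plane.\<close>
    define h where "h z = poly P1 z * cnj (poly Q1 z)" for z
    have h: "poly P1 z / poly Q1 z = h z * of_real (inverse ((cmod (poly Q1 z))\<^sup>2))" if "cmod z = 1" for z
      using Q1_circle[OF that] by (simp add: h_def complex_norm_square field_simps del: of_real_power)
    have "h z \<in> \<real>\<^sub>\<ge>\<^sub>0"
    proof (rule closed_property_on_circle[OF \<open>finite S\<close>, of h])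
      fix w assume w: "cmod w = 1" "w \<notin> S"
      then have "h w = F w * of_real ((cmod (poly Q1 w))\<^sup>2)"
        using Q1_circle by (simp add: F_eq h_def complex_norm_square del: of_real_power)
      also have "\<dots> \<in> \<real>\<^sub>\<ge>\<^sub>0" using assms(5)[OF w(1)] by (intro nonneg_Reals_mult_I) auto
      finally show "h w \<in> \<real>\<^sub>\<ge>\<^sub>0" .
    qed (auto simp: h_def[abs_def] that intro!: continuous_intros)
    then show ?thesis unfolding h[OF that] by (intro nonneg_Reals_mult_I) auto
  qed
  obtain A Q0 where "Q0 dvd Q1" and Q0: "\<And>z. poly Q0 z = 0 \<Longrightarrow> cmod z < 1" "degree A < degree Q0"
    and fac: "\<And>z. cmod z = 1 \<Longrightarrow> poly P1 z / poly Q1 z = of_real ((cmod (poly A z / poly Q0 z))\<^sup>2)"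
    using nonneg_rational_spectral_factor[OF \<open>P1 \<noteq> 0\<close> deg Q1_circle nonneg] by metis
  define B where "B = monom 1 (degree Q0 - 1 - degree A) * reflect_poly A"
  obtain f where rad: "fps_conv_radius f > 1"
    and val: "\<And>z. cmod z = 1 \<Longrightarrow> poly A z / poly Q0 z = cnj z * eval_fps f (cnj z)"
    and f: "f * fps_of_poly (reflect_poly Q0) = fps_of_poly B"
    using rational_power_series_at_infinity[OF Q0(2,1)] unfolding B_def by metis
  obtain H where H: "Q = Q0 * H"
    using \<open>Q0 dvd Q1\<close> PQ(2) by (metis dvd_mult2 dvdE)
  have "H \<noteq> 0" "Q0 \<noteq> 0" using H assms(1) by auto
  \<comment> \<open>Multiplying by the reversed cofactor \<open>H\<close> passes from the recurrence
    for \<open>Q0\<close> to the one for \<open>Q\<close>; the right-hand side stays below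
    \<open>degree Q\<close>.\<close>
  have "f * fps_of_poly (reflect_poly Q) = fps_of_poly (B * reflect_poly H)"
    by (simp add: H reflect_poly_mult fps_of_poly_mult f flip: mult.assoc)
  moreover have "degree (B * reflect_poly H) < degree Q"
  proof -
    have "degree B \<le> degree Q0 - 1"
      unfolding B_def using degree_mult_le[of "monom 1 (degree Q0 - 1 - degree A)" "reflect_poly A"]
        degree_monom_le[of "1 :: complex" "degree Q0 - 1 - degree A"] degree_reflect_poly_le[of A] Q0(2)
      by linarith
    moreover have "degree Q = degree Q0 + degree H"
      unfolding H using \<open>H \<noteq> 0\<close> \<open>Q0 \<noteq> 0\<close> by (rule degree_mult_eq[rotated])
    ultimately show ?thesis
      using degree_mult_le[of B "reflect_poly H"] degree_reflect_poly_le[of H] Q0(2) by linarith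
  qed
  ultimately have rec: "(\<Sum>i\<le>degree Q. coeff Q i * fps_nth f (n + i)) = 0" for n
    by (rule fps_quotient_recurrence)
  define a where "a n = fps_nth f n" for n
  have abs: "summable (\<lambda>n. cmod (a n))"
    using norm_summable_fps[of 1 f] rad by (simp add: a_def one_ereal_def)
  then have sq: "summable (\<lambda>n. (cmod (a n))\<^sup>2)"
    by (rule summable_square_if_summable) simp
  have ker: "a \<in> ker_shift Q"
    using sq rec by (auto simp: ker_shift_def ell2_def poly_op_def backward_shift_power a_def)
  \<comment> \<open>The factor \<open>cnj z\<close> in \<open>val\<close> has modulus 1 and drops
    out of the squared modulus.\<close>
  have "circle_coeff F j = circle_coeff (\<lambda>z. of_real ((cmod (\<Sum>n. a n * cnj z ^ n))\<^sup>2)) j" for j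
  proof (rule circle_coeff_cong[OF \<open>finite S\<close>])
    fix z assume "cmod z = 1" "z \<notin> S"
    then show "F z = of_real ((cmod (\<Sum>n. a n * cnj z ^ n))\<^sup>2)"
      by (simp add: F_eq fac val norm_mult eval_fps_def a_def)
  qed
  then have c: "(\<lambda>n. a n * cnj (a (n + j))) sums circle_coeff F j" for j
    using circle_coeff_norm_square_power_series[OF abs] by simp
  \<comment> \<open>In \<open>c\<close> the shift sits on the conjugated factor, in the inner
    product on the first one, hence the conjugate; the modulus is unaffected.\<close>
  have "(\<lambda>n. a (n + k) * cnj (a n)) sums cnj (circle_coeff F k)"
    using c[of k, THEN sums_cnj[THEN iffD2]] by (simp add: mult.commute)
  then have "ell2_inner ((restricted_shift Q ^^ k) a) a = cnj (circle_coeff F k)"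
    by (simp add: restricted_shift_power[OF ker] ell2_inner_def backward_shift_power sums_iff)
  moreover have "(\<lambda>n. (cmod (a n))\<^sup>2) sums Re (circle_coeff F 0)"
    using c[of 0, THEN sums_Re] by (simp add: cmod_power2 flip: power2_eq_square)
  then have "(\<Sum>n. (cmod (a n))\<^sup>2) = Re (circle_coeff F 0)"
    by (simp add: sums_iff)
  then have "(ell2_norm a)\<^sup>2 = Re (circle_coeff F 0)"
    using suminf_nonneg[OF sq] by (simp add: ell2_norm_def)
  ultimately show ?thesis
    using ell2_inner_le_numerical_radius[OF ker, of k] by simp
qed

end
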